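(* Let $G=(X,E)$ be a connected graph of finite geometry and let $P$ be a probability kernel on $X$ with $P(x,y)>0\iff x\sim y$, for which there exist a probability kernel $\widehat P:X\times X\to[0,1]$ and a measure $\mu:X\to(0,\infty)$ with $\mu(x)P(x,y)=\mu(y)\widehat P(y,x)$ for all $x,y\in X$. Let $V$ be a confining potential for which there is some $x_0\in X$ such that $V(x)=V(y)$ if $d(x,x_0)=d(y,x_0)$, and $V(x)\ge V(y)$ if $d(x,x_0)\ge d(y,x_0)$. Denote by $\{\mathcal U_n:n\in\mathbb N_0\}$ the corresponding Feynman--Kac semigroup. If the ground state of the dual semigroup satisfies $\widehat\varphi_0\in\ell^1(X,\mu)$, and if $$\inf\{P(x,y):x,y\in X,\ x\sim y\}>0,$$ then $\{\mathcal U_n:n\in\mathbb N_0\}$ does not have the aIUC property.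
   Context: $X$ is a countably infinite set, $\mathbb N=\{1,2,\dots\}$, $\mathbb N_0=\mathbb N\cup\{0\}$. A graph $G=(X,E)$ has edge set $E\subset\{\{x,y\}:x,y\in X\}$; $x\sim y$ means $\{x,y\}\in E$. $G$ has finite geometry if every $x\in X$ has finitely many neighbours; it is connected if any two different vertices are joined by a path of successive neighbours; $d(x,y)$ is the graph (geodesic) distance, i.e. the length (number of edges) of a shortest path. A probability kernel satisfies $\sum_yP(x,y)=1$ for all $x$. A potential is a function $V:X\to(0,\infty)$ with $\inf_{x\in X}V(x)>0$ (standing assumption). It is confining if for every $M\in\mathbb N$ there is a finite set $B_M\subset X$ with $V(x)\ge M$ for all $x\in X\setminus B_M$. Let $\mathcal U f(x)=\frac1{V(x)}\sum_{y}P(x,y)f(y)$ and $\widehat{\mathcal U}f(x)=\sum_y\widehat P(x,y)\frac1{V(y)}f(y)$ (mutually adjoint on $\ell^2(\mu)$), $\mathcal U_n=\mathcal U^n$, with kernel with respect to $\mu$ given by $u_1(x,y)=\frac{P(x,y)}{V(x)\mu(y)}$, $u_{n+1}(x,y)=\sum_zu_n(x,z)u_1(z,y)\mu(z)$. The operators $\mathcal U,\widehat{\mathcal U}$ are compact on $\ell^2(\mu)$, and $\lambda_0:=\sup_{\lambda\in\sigma(\mathcal U)}|\lambda|=\sup_{\lambda\in\sigma(\widehat{\mathcal U})}|\lambda|>0$ is a simple eigenvalue of both; $\varphi_0,\widehat\varphi_0$ denote the corresponding strictly positive eigenfunctions (ground states), $\mathcal U\varphi_0=\lambda_0\varphi_0$,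 $\widehat{\mathcal U}\widehat\varphi_0=\lambda_0\widehat\varphi_0$, normalized by $\|\varphi_0\|_{\ell^2(\mu)}=\|\widehat\varphi_0\|_{\ell^2(\mu)}=1$. $\{\mathcal U_n\}$ has the aIUC (asymptotic intrinsic ultracontractivity) property if there is $n_0\in\mathbb N$ with $\sup_{x,y\in X}\frac{u_{n_0}(x,y)}{\lambda_0^{n_0}\varphi_0(x)\widehat\varphi_0(y)}<\infty$; equivalently, $f\mapsto\lambda_0^{-n_0}\varphi_0^{-1}\mathcal U_{n_0}(f\varphi_0)$ is bounded from $\ell^1(\nu)$ to $\ell^\infty(\nu)$, where $\nu=\varphi_0\widehat\varphi_0\mu$. *)

theory Defs
  imports "HOL-Analysis.Analysis"
begin

text \<open>The countably infinite vertex set \<open>X\<close> is the universe of the type \<open>'a\<close>.  Edges are sets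
  \<open>{x, y}\<close>; the case \<open>x = y\<close> (a loop) is allowed.\<close>

definition graph :: "'a set set \<Rightarrow> bool" where
  "graph E \<longleftrightarrow> E \<subseteq> {{x, y} | x y. True}"

definition adjacent :: "'a set set \<Rightarrow> 'a \<Rightarrow> 'a \<Rightarrow> bool" where
  "adjacent E x y \<longleftrightarrow> {x, y} \<in> E"

definition finite_geometry :: "'a set set \<Rightarrow> bool" where
  "finite_geometry E \<longleftrightarrow> (\<forall>x. finite {y. adjacent E x y})"

definition graph_path :: "'a set set \<Rightarrow> 'a \<Rightarrow> 'a \<Rightarrow> 'a list \<Rightarrow> bool" where
  "graph_path E x y xs \<longleftrightarrow>
     xs \<noteq> [] \<and> hd xs = x \<and> last xs = y \<and> successively (adjacent E) xs"

definition graph_connected :: "'a set set \<Rightarrow> bool" where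
  "graph_connected E \<longleftrightarrow> (\<forall>x y. x \<noteq> y \<longrightarrow> (\<exists>xs. graph_path E x y xs))"

text \<open>A path listed by its \<open>n + 1\<close> vertices has \<open>n\<close> edges.  The value is only meaningful
  for vertices joined by a path.\<close>

definition graph_dist :: "'a set set \<Rightarrow> 'a \<Rightarrow> 'a \<Rightarrow> nat" where
  "graph_dist E x y = (LEAST n. \<exists>xs. graph_path E x y xs \<and> length xs = n + 1)"

definition prob_kernel :: "('a \<Rightarrow> 'a \<Rightarrow> real) \<Rightarrow> bool" where
  "prob_kernel P \<longleftrightarrow>
     (\<forall>x y. 0 \<le> P x y \<and> P x y \<le> 1) \<and> (\<forall>x. ((\<lambda>y. P x y) has_sum 1) UNIV)"

definition potential :: "('a \<Rightarrow> real) \<Rightarrow> bool" where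
  "potential V \<longleftrightarrow> (\<forall>x. V x > 0) \<and> (INF x. V x) > 0"

definition confining :: "('a \<Rightarrow> real) \<Rightarrow> bool" where
  "confining V \<longleftrightarrow> (\<forall>M::nat. M \<ge> 1 \<longrightarrow> (\<exists>B. finite B \<and> (\<forall>x. x \<notin> B \<longrightarrow> V x \<ge> real M)))"

text \<open>The weighted sequence spaces and the operators are polymorphic in the range of the
  functions: the spectrum is taken over complex-valued functions, while the ground states
  are real-valued.\<close>

definition ell1 :: "('a \<Rightarrow> real) \<Rightarrow> ('a \<Rightarrow> 'b::real_normed_vector) set" where
  "ell1 \<mu> = {f. (\<lambda>x. norm (f x) * \<mu> x) summable_on UNIV}"

definition ell2 :: "('a \<Rightarrow> real) \<Rightarrow> ('a \<Rightarrow> 'b::real_normed_vector) set" where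
  "ell2 \<mu> = {f. (\<lambda>x. (norm (f x))\<^sup>2 * \<mu> x) summable_on UNIV}"

definition ell2_norm :: "('a \<Rightarrow> real) \<Rightarrow> ('a \<Rightarrow> 'b::real_normed_vector) \<Rightarrow> real" where
  "ell2_norm \<mu> f = sqrt (\<Sum>\<^sub>\<infinity>x. (norm (f x))\<^sup>2 * \<mu> x)"

definition fk_op ::
  "('a \<Rightarrow> 'a \<Rightarrow> real) \<Rightarrow> ('a \<Rightarrow> real) \<Rightarrow> ('a \<Rightarrow> 'b::real_normed_vector) \<Rightarrow> 'a \<Rightarrow> 'b" where
  "fk_op P V f x = (1 / V x) *\<^sub>R (\<Sum>\<^sub>\<infinity>y. P x y *\<^sub>R f y)"

definition fk_dual_op ::
  "('a \<Rightarrow> 'a \<Rightarrow> real) \<Rightarrow> ('a \<Rightarrow> real) \<Rightarrow> ('a \<Rightarrow> 'b::real_normed_vector) \<Rightarrow> 'a \<Rightarrow> 'b" where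
  "fk_dual_op P' V f x = (\<Sum>\<^sub>\<infinity>y. (P' x y * (1 / V y)) *\<^sub>R f y)"

text \<open>The kernel of the \<open>n\<close>-th power of \<open>fk_op P V\<close> with respect to \<open>\<mu>\<close>; at index 0 this is
  the kernel of the identity.\<close>

fun fk_kernel ::
  "('a \<Rightarrow> 'a \<Rightarrow> real) \<Rightarrow> ('a \<Rightarrow> real) \<Rightarrow> ('a \<Rightarrow> real) \<Rightarrow> nat \<Rightarrow> 'a \<Rightarrow> 'a \<Rightarrow> real" where
  "fk_kernel P V \<mu> 0 x y = (if x = y then 1 / \<mu> y else 0)"
| "fk_kernel P V \<mu> (Suc 0) x y = P x y / (V x * \<mu> y)"
| "fk_kernel P V \<mu> (Suc (Suc n)) x y =
     (\<Sum>\<^sub>\<infinity>z. fk_kernel P V \<mu> (Suc n) x z * fk_kernel P V \<mu> (Suc 0) z y * \<mu> z)"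

text \<open>The complement of the resolvent set: \<open>z\<close> is regular iff \<open>z - T\<close> is a bijection of the
  complex \<open>ell2 \<mu>\<close> onto itself with bounded inverse.\<close>

definition ell2_spectrum ::
  "('a \<Rightarrow> real) \<Rightarrow> (('a \<Rightarrow> complex) \<Rightarrow> 'a \<Rightarrow> complex) \<Rightarrow> complex set" where
  "ell2_spectrum \<mu> T = {z. \<not> (
     bij_betw (\<lambda>f x. z * f x - T f x) (ell2 \<mu>) (ell2 \<mu>) \<and>
     (\<exists>C. \<forall>f\<in>ell2 \<mu>. ell2_norm \<mu> f \<le> C * ell2_norm \<mu> (\<lambda>x. z * f x - T f x)))}"

definition ell2_spectral_radius ::
  "('a \<Rightarrow> real) \<Rightarrow> (('a \<Rightarrow> complex) \<Rightarrow> 'a \<Rightarrow> complex) \<Rightarrow> real" where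
  "ell2_spectral_radius \<mu> T = (SUP z\<in>ell2_spectrum \<mu> T. cmod z)"

definition fk_lambda0 ::
  "('a \<Rightarrow> 'a \<Rightarrow> real) \<Rightarrow> ('a \<Rightarrow> real) \<Rightarrow> ('a \<Rightarrow> real) \<Rightarrow> real" where
  "fk_lambda0 P V \<mu> = ell2_spectral_radius \<mu> (fk_op P V)"

definition ground_state ::
  "('a \<Rightarrow> real) \<Rightarrow> (('a \<Rightarrow> real) \<Rightarrow> 'a \<Rightarrow> real) \<Rightarrow> real \<Rightarrow> ('a \<Rightarrow> real) \<Rightarrow> bool" where
  "ground_state \<mu> T l \<phi> \<longleftrightarrow>
     \<phi> \<in> ell2 \<mu> \<and> (\<forall>x. \<phi> x > 0) \<and> (\<forall>x. T \<phi> x = l * \<phi> x) \<and> ell2_norm \<mu> \<phi> = 1"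

text \<open>Asymptotic intrinsic ultracontractivity of the Feynman--Kac semigroup with ground
  state \<open>\<phi>\<close> and dual ground state \<open>\<phi>'\<close>.\<close>

definition aIUC ::
  "('a \<Rightarrow> 'a \<Rightarrow> real) \<Rightarrow> ('a \<Rightarrow> real) \<Rightarrow> ('a \<Rightarrow> real) \<Rightarrow> ('a \<Rightarrow> real) \<Rightarrow> ('a \<Rightarrow> real) \<Rightarrow> bool" where
  "aIUC P V \<mu> \<phi> \<phi>' \<longleftrightarrow> (\<exists>n\<ge>1. bdd_above
     (range (\<lambda>(x, y). fk_kernel P V \<mu> n x y / (fk_lambda0 P V \<mu> ^ n * \<phi> x * \<phi>' y))))"

end

(* If u_n(x,y) <= C lambda^n phi(x) phi'(y), then following a geodesic from x towards x0 for
   n steps to a vertex y shows, since phi' mu is bounded, that phi(x) is at least a constant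
   times the product of p / (lambda V) along the geodesic, where p > 0 is the infimum of the
   transition probabilities. Iterating lambda V phi = P phi along the radially increasing V
   bounds phi(x) from above by the product of 1 / (lambda V) over the same n spheres times
   the supremum of phi over the vertices at distance at least d(x,x0) - n. That supremum
   tends to 0, so the two bounds are incompatible far out. *)

theory Submission
  imports Defs
begin

section \<open>Sums of nonnegative and of finitely supported functions\<close>

lemma le_infsum_of_nonneg:
  fixes f :: "'a \<Rightarrow> real"
  assumes "f summable_on UNIV" and "\<And>x. 0 \<le> f x"
  shows "f x \<le> (\<Sum>\<^sub>\<infinity>x. f x)"
proof -
  have "sum f {x} \<le> infsum f UNIV"
    using assms by (intro finite_sum_le_infsum) auto
  then show ?thesis by simp
qed

lemma infsum_eq_sum_if_zero_outside:
  fixes f :: "'a \<Rightarrow> 'b::{comm_monoid_add,t2_space}"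
  assumes "finite A" and "\<And>x. x \<notin> A \<Longrightarrow> f x = 0"
  shows "(\<Sum>\<^sub>\<infinity>x. f x) = sum f A"
proof -
  have "infsum f UNIV = infsum f A"
    using assms(2) by (intro infsum_cong_neutral) auto
  then show ?thesis using assms(1) by simp
qed

subsection \<open>Spheres around a vertex\<close>

lemma adjacent_commute: "adjacent E x y \<longleftrightarrow> adjacent E y x"
  by (simp add: adjacent_def insert_commute)

text \<open>Connectedness makes the \<open>LEAST\<close> in \<open>graph_dist\<close> range over a
  nonempty set of lengths, so the minimum is attained.\<close>

lemma shortest_path_exists:
  assumes "graph_connected E"
  shows "\<exists>xs. graph_path E x y xs \<and> length xs = graph_dist E x y + 1"
proof -
  have "\<exists>xs. graph_path E x y xs"
  proof (cases "x = y")
    case True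
    then have "graph_path E x y [x]" by (simp add: graph_path_def)
    then show ?thesis ..
  next
    case False
    then show ?thesis using assms by (simp add: graph_connected_def)
  qed
  then obtain xs where xs: "graph_path E x y xs" ..
  then have "length xs = (length xs - 1) + 1"
    by (cases xs) (auto simp: graph_path_def)
  with xs have "\<exists>n xs. graph_path E x y xs \<and> length xs = n + 1" by blast
  then show ?thesis unfolding graph_dist_def by (rule LeastI_ex)
qed

lemma graph_dist_le:
  assumes "graph_path E x y xs" and "length xs = n + 1"
  shows "graph_dist E x y \<le> n"
  unfolding graph_dist_def using assms by (intro Least_le) blast

lemma graph_dist_adjacent_le:
  assumes "graph_connected E" and "adjacent E x y"
  shows "graph_dist E x z \<le> graph_dist E y z + 1"
proof -
  obtain ys where ys: "graph_path E y z ys" "length ys = graph_dist E y z + 1"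
    using shortest_path_exists[OF assms(1)] by blast
  have "graph_path E x z (x # ys)"
    using ys(1) assms(2) by (cases ys) (auto simp: graph_path_def)
  then show ?thesis using ys(2) by (intro graph_dist_le) auto
qed

text \<open>The tail of a shortest path shows that its second vertex is at distance at most
  \<open>k\<close>; one edge changes the distance by at most 1, so it is no closer.\<close>

lemma graph_dist_descend:
  assumes "graph_connected E" and "graph_dist E x z = Suc k"
  shows "\<exists>y. adjacent E x y \<and> graph_dist E y z = k"
proof -
  obtain xs where xs: "graph_path E x z xs" "length xs = Suc (Suc k)"
    using shortest_path_exists[OF assms(1), of x z] assms(2) by auto
  then obtain y ys where xs_eq: "xs = x # y # ys"
    by (auto simp: graph_path_def length_Suc_conv)
  have adj: "adjacent E x y" using xs(1) by (simp add: graph_path_def xs_eq)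
  have "graph_path E y z (y # ys)" using xs(1) by (auto simp: graph_path_def xs_eq)
  then have "graph_dist E y z \<le> k"
    using xs(2) by (intro graph_dist_le) (auto simp: xs_eq)
  then show ?thesis
    using adj graph_dist_adjacent_le[OF assms(1) adj, of z] assms(2) by force
qed

text \<open>By descent, each vertex on the next sphere is a neighbour of the previous ball, and a
  finite ball has finitely many neighbours.\<close>

lemma finite_graph_ball:
  assumes "graph_connected E" and "finite_geometry E"
  shows "finite {x. graph_dist E x z \<le> r}"
proof (induction r)
  case 0
  have "x = z" if "graph_dist E x z = 0" for x
    using shortest_path_exists[OF assms(1), of x z] that
    by (auto simp: graph_path_def length_Suc_conv)
  then have "{x. graph_dist E x z \<le> 0} \<subseteq> {z}" by auto
  then show ?case by (rule finite_subset) simp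
next
  case (Suc r)
  let ?B = "{x. graph_dist E x z \<le> r}"
  have "{x. graph_dist E x z \<le> Suc r} \<subseteq> ?B \<union> (\<Union>y\<in>?B. {x. adjacent E y x})"
  proof
    fix x assume "x \<in> {x. graph_dist E x z \<le> Suc r}"
    then consider "graph_dist E x z \<le> r" | "graph_dist E x z = Suc r" by force
    then show "x \<in> ?B \<union> (\<Union>y\<in>?B. {x. adjacent E y x})"
    proof cases
      case 2
      then show ?thesis
        using graph_dist_descend[OF assms(1)] adjacent_commute[of E] by blast
    qed auto
  qed
  moreover have "finite (?B \<union> (\<Union>y\<in>?B. {x. adjacent E y x}))"
    using Suc assms(2) by (auto simp: finite_geometry_def)
  ultimately show ?case by (rule finite_subset)
qed

text \<open>Finite balls cannot exhaust an infinite graph, so some vertex lies at distance at least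
  \<open>r\<close>; descending from it meets the sphere of radius \<open>r\<close>.\<close>

lemma graph_dist_attained:
  fixes E :: "'a set set"
  assumes "infinite (UNIV :: 'a set)" and "graph_connected E" and "finite_geometry E"
  shows "\<exists>x. graph_dist E x z = r"
proof -
  have "{x. graph_dist E x z \<le> r} \<noteq> UNIV"
    using finite_graph_ball[OF assms(2,3), of z r] assms(1) by metis
  then obtain x where "graph_dist E x z \<ge> r" by (metis (mono_tags, lifting) UNIV_eq_I mem_Collect_eq nle_le)
  then show ?thesis
  proof (induction "graph_dist E x z - r" arbitrary: x)
    case 0
    then show ?case by (metis diff_is_0_eq le_antisym)
  next
    case (Suc k)
    then have "graph_dist E x z = Suc (r + k)" by linarith
    then obtain y where "graph_dist E y z = r + k"
      using graph_dist_descend[OF assms(2)] by blast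
    then show ?case using Suc.hyps(1)[of y] by simp
  qed
qed

subsection \<open>The kernel and the ground state\<close>

context
  fixes P :: "'a \<Rightarrow> 'a \<Rightarrow> real" and V \<mu> :: "'a \<Rightarrow> real"
  assumes P_nonneg: "\<And>x y. 0 \<le> P x y" and V_pos: "\<And>x. 0 < V x" and \<mu>_pos: "\<And>x. 0 < \<mu> x"
begin

lemma fk_kernel_nonneg: "0 \<le> fk_kernel P V \<mu> n x y"
proof (induction n arbitrary: y)
  case 0
  then show ?case using \<mu>_pos[of y] by simp
next
  case (Suc n)
  have one: "0 \<le> fk_kernel P V \<mu> (Suc 0) z y" for z
    using P_nonneg[of z y] V_pos[of z] \<mu>_pos[of y] by simp
  show ?case
  proof (cases n)
    case 0
    then show ?thesis using one by simp
  next
    case m: (Suc m)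
    show ?thesis
      unfolding m fk_kernel.simps(3) using Suc.IH[unfolded m] one \<mu>_pos
      by (intro infsum_nonneg mult_nonneg_nonneg) (auto simp: less_imp_le)
  qed
qed

text \<open>Only the intermediate vertex \<open>z\<close> of the composition sum is kept. The
  factors \<open>\<mu>\<close> turn densities into transition weights, and finitely many
  predecessors of \<open>y\<close> make the \<open>infsum\<close> a genuine finite sum.\<close>

lemma fk_kernel_Suc_ge:
  assumes "finite {z. P z y \<noteq> 0}"
  shows "fk_kernel P V \<mu> n x z * \<mu> z * (P z y / V z) \<le> fk_kernel P V \<mu> (Suc n) x y * \<mu> y"
proof (cases n)
  case 0
  then show ?thesis using V_pos[of z] \<mu>_pos[of z] \<mu>_pos[of y] P_nonneg[of z y]
    P_nonneg[of x y] V_pos[of x]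
    by auto
next
  case (Suc m)
  let ?f = "\<lambda>z. fk_kernel P V \<mu> n x z * fk_kernel P V \<mu> (Suc 0) z y * \<mu> z"
  have nonneg: "0 \<le> ?f z" for z
    using fk_kernel_nonneg[of n x z] fk_kernel_nonneg[of "Suc 0" z y] \<mu>_pos[of z]
    by (intro mult_nonneg_nonneg) auto
  have eq: "fk_kernel P V \<mu> (Suc n) x y = sum ?f {z. P z y \<noteq> 0}"
    unfolding Suc fk_kernel.simps(3)
    by (rule infsum_eq_sum_if_zero_outside[OF assms]) simp
  have "?f z \<le> sum ?f {z. P z y \<noteq> 0}"
  proof (cases "P z y = 0")
    case True
    then show ?thesis using sum_nonneg[of "{z. P z y \<noteq> 0}" ?f] nonneg by simp
  next
    case False
    then show ?thesis using member_le_sum[of z "{z. P z y \<noteq> 0}" ?f] nonneg assms by simp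
  qed
  then have "?f z * \<mu> y \<le> fk_kernel P V \<mu> (Suc n) x y * \<mu> y"
    unfolding eq using \<mu>_pos[of y] by (intro mult_right_mono) auto
  moreover have "?f z * \<mu> y = fk_kernel P V \<mu> n x z * \<mu> z * (P z y / V z)"
    using \<mu>_pos[of y] by (simp add: field_simps)
  ultimately show ?thesis by simp
qed

text \<open>Each step towards the centre contributes at least \<open>p / W k\<close>, where
  \<open>k\<close> is the level it leaves. Hence the end level \<open>s\<close> is missing from the
  product. The start \<open>x\<close> stays fixed while the induction appends steps at the lower
  end.\<close>

lemma fk_kernel_ge_prod_spheres:
  fixes \<rho> :: "'a \<Rightarrow> nat"
  assumes "\<And>y. finite {z. P z y \<noteq> 0}" and "p \<ge> 0"
    and descend: "\<And>x k. \<rho> x = Suc k \<Longrightarrow> \<exists>y. p \<le> P x y \<and> \<rho> y = k"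
    and V_eq: "\<And>x. V x = W (\<rho> x)"
    and "\<rho> x = s + n"
  shows "\<exists>y. (\<Prod>k\<in>{s<..s + n}. p / W k) \<le> fk_kernel P V \<mu> n x y * \<mu> y \<and> \<rho> y = s"
  using \<open>\<rho> x = s + n\<close>
proof (induction n arbitrary: s)
  case 0
  then show ?case using \<mu>_pos[of x] by (intro exI[of _ x]) auto
next
  case (Suc n)
  then obtain z where z: "(\<Prod>k\<in>{Suc s<..Suc s + n}. p / W k) \<le> fk_kernel P V \<mu> n x z * \<mu> z"
    "\<rho> z = Suc s"
    using Suc.IH[of "Suc s"] by auto
  obtain y where y: "p \<le> P z y" "\<rho> y = s" using descend[OF z(2)] by blast
  have "{s<..s + Suc n} = insert (Suc s) {Suc s<..Suc s + n}" by auto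
  then have "(\<Prod>k\<in>{s<..s + Suc n}. p / W k) = (\<Prod>k\<in>{Suc s<..Suc s + n}. p / W k) * (p / V z)"
    by (simp add: V_eq z(2))
  also have "\<dots> \<le> fk_kernel P V \<mu> n x z * \<mu> z * (P z y / V z)"
    using z(1) y(1) V_pos[of z] \<open>p \<ge> 0\<close> \<mu>_pos[of z] fk_kernel_nonneg[of n x z]
    by (intro mult_mono divide_right_mono) auto
  also have "\<dots> \<le> fk_kernel P V \<mu> (Suc n) x y * \<mu> y"
    by (rule fk_kernel_Suc_ge[OF assms(1)])
  finally show ?case using y(2) by blast
qed

end

section \<open>Upper bounds for a positive eigenfunction\<close>

context
  fixes P :: "'a \<Rightarrow> 'a \<Rightarrow> real" and V \<phi> :: "'a \<Rightarrow> real" and l :: real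
  assumes kernel: "prob_kernel P" and finite_range: "\<And>x. finite {y. P x y \<noteq> 0}"
    and V_pos: "\<And>x. 0 < V x" and \<phi>_pos: "\<And>x. 0 < \<phi> x"
    and eigen: "\<And>x. fk_op P V \<phi> x = l * \<phi> x"
begin

lemma P_nonneg: "0 \<le> P x y"
  using kernel by (simp add: prob_kernel_def)

lemma sum_kernel: "(\<Sum>y | P x y \<noteq> 0. P x y) = 1"
proof -
  have "(\<Sum>\<^sub>\<infinity>y. P x y) = 1" using kernel by (auto simp: prob_kernel_def intro: infsumI)
  then show ?thesis
    using infsum_eq_sum_if_zero_outside[OF finite_range, of x "P x"] by simp
qed

lemma eigen_sum: "l * V x * \<phi> x = (\<Sum>y | P x y \<noteq> 0. P x y * \<phi> y)"
proof -
  have "(\<Sum>\<^sub>\<infinity>y. P x y * \<phi> y) = (\<Sum>y | P x y \<noteq> 0. P x y * \<phi> y)"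
    by (rule infsum_eq_sum_if_zero_outside[OF finite_range]) simp
  then show ?thesis using eigen[of x] V_pos[of x] by (simp add: fk_op_def field_simps)
qed

text \<open>The equation at a single vertex suffices: \<open>V x\<close>, \<open>\<phi> x\<close>
  and the average of \<open>\<phi>\<close> over the neighbours are all positive. This gives
  positivity of the spectral radius without spectral theory.\<close>

lemma eigenvalue_pos: "0 < l"
proof -
  fix x
  have "0 < (\<Sum>y | P x y \<noteq> 0. P x y * \<phi> y)"
  proof (rule sum_pos[OF finite_range])
    show "{y. P x y \<noteq> 0} \<noteq> {}" using sum_kernel[of x] by fastforce
    show "0 < P x y * \<phi> y" if "y \<in> {y. P x y \<noteq> 0}" for y
      using that P_nonneg[of x y] \<phi>_pos[of y] by (auto simp: less_le)
  qed
  then show ?thesis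
    unfolding eigen_sum[symmetric] using V_pos[of x] \<phi>_pos[of x]
    by (auto simp: zero_less_mult_iff)
qed

lemma ground_state_le:
  assumes "\<And>y. P x y \<noteq> 0 \<Longrightarrow> \<phi> y \<le> K"
  shows "\<phi> x \<le> K / (l * V x)"
proof -
  have "l * V x * \<phi> x \<le> (\<Sum>y | P x y \<noteq> 0. P x y * K)"
    unfolding eigen_sum using assms P_nonneg by (intro sum_mono mult_left_mono) auto
  also have "\<dots> = K" by (simp add: sum_distrib_right[symmetric] sum_kernel)
  finally show ?thesis using eigenvalue_pos V_pos[of x] by (simp add: field_simps)
qed

text \<open>The left-hand side is the \<open>P x\<close>-average of \<open>\<phi>\<close>, and some
  neighbour must reach the average.\<close>

lemma neighbour_ge: "\<exists>y. P x y \<noteq> 0 \<and> l * V x * \<phi> x \<le> \<phi> y"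
proof (rule ccontr)
  assume "\<not> ?thesis"
  then have less: "\<phi> y < l * V x * \<phi> x" if "P x y \<noteq> 0" for y using that by force
  let ?N = "{y. P x y \<noteq> 0}"
  have "?N \<noteq> {}" using sum_kernel[of x] by fastforce
  then have "(\<Sum>y\<in>?N. P x y * \<phi> y) < (\<Sum>y\<in>?N. P x y * (l * V x * \<phi> x))"
    using less P_nonneg
    by (intro sum_strict_mono[OF finite_range] mult_strict_left_mono) (auto simp: less_le)
  then show False
    by (simp add: eigen_sum[symmetric] sum_distrib_right[symmetric] sum_kernel)
qed

text \<open>Above its maximum over a finite set \<open>\<phi>\<close> would have to grow along some path by a factor
  of at least \<open>2 / p\<close> per step, whereas \<open>\<mu>\<close> loses at most a factor \<open>p\<close>; so \<open>\<phi>\<close> would not be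
  in \<open>ell2 \<mu>\<close>.\<close>

lemma ground_state_bounded:
  assumes "confining V" and "\<phi> \<in> ell2 \<mu>" and \<mu>_pos: "\<And>x. 0 < \<mu> x"
    and p: "0 < p" "p \<le> 1" and \<mu>_step: "\<And>x y. P x y \<noteq> 0 \<Longrightarrow> p * \<mu> x \<le> \<mu> y"
  shows "\<exists>K. \<forall>x. \<phi> x \<le> K"
proof -
  let ?g = "\<lambda>x. (\<phi> x)\<^sup>2 * \<mu> x"
  have "?g summable_on UNIV" using assms(2) by (simp add: ell2_def)
  then have g_le: "?g x \<le> (\<Sum>\<^sub>\<infinity>x. ?g x)" for x
    using \<mu>_pos by (intro le_infsum_of_nonneg) (auto simp: less_imp_le)
  \<comment> \<open>This threshold makes \<open>l * V x\<close> at least \<open>2 / p\<close>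
    outside \<open>B\<close>. Taking \<open>max M 1\<close> below respects the restriction to
    positive \<open>M\<close> in \<open>confining\<close>.\<close>
  obtain M :: nat where M: "2 / (p * l) \<le> real M" using real_arch_simple by blast
  obtain B where B: "finite B" "\<And>x. x \<notin> B \<Longrightarrow> real (max M 1) \<le> V x"
    using assms(1) unfolding confining_def by (metis max.cobounded2)
  have lV: "2 / p \<le> l * V x" if "x \<notin> B" for x
  proof -
    have "2 / (p * l) \<le> V x" using M B(2)[OF that] by simp
    then show ?thesis using eigenvalue_pos p by (simp add: field_simps)
  qed
  \<comment> \<open>The extra 0 keeps \<open>Max\<close> meaningful when \<open>B\<close> is
    empty.\<close>
  define K where "K = Max (insert 0 (\<phi> ` B))"
  have K: "\<phi> x \<le> K" if "x \<in> B" for x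
    using that B(1) unfolding K_def by (intro Max_ge) auto
  have step: "\<exists>y. K < \<phi> y \<and> 2 * ?g x \<le> ?g y" if "K < \<phi> x" for x
  proof -
    obtain y where y: "P x y \<noteq> 0" "l * V x * \<phi> x \<le> \<phi> y" using neighbour_ge by blast
    have "x \<notin> B" using K that by force
    then have "2 / p * \<phi> x \<le> l * V x * \<phi> x"
      using lV \<phi>_pos[of x] by (intro mult_right_mono) auto
    then have grow: "2 / p * \<phi> x \<le> \<phi> y" using y(2) by simp
    have "1 * \<phi> x \<le> 2 / p * \<phi> x"
      using p \<phi>_pos[of x] by (intro mult_right_mono) (auto simp: field_simps)
    then have "K < \<phi> y" using grow that by simp
    moreover have "2 * ?g x \<le> ?g y"
    proof -
      \<comment> \<open>Squaring the growth factor \<open>2 / p\<close> and paying the loss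
        \<open>p\<close> of \<open>\<mu>\<close> leaves \<open>4 / p\<close>, which exceeds 2
        because \<open>p\<close> is at most 1.\<close>
      have "2 * ?g x \<le> 4 / p * ?g x"
        using p \<mu>_pos[of x] by (intro mult_right_mono) (auto simp: field_simps)
      also have "\<dots> = (2 / p * \<phi> x)\<^sup>2 * (p * \<mu> x)"
        using p by (simp add: power2_eq_square field_simps)
      also have "\<dots> \<le> ?g y"
        using grow \<mu>_step[OF y(1)] p \<phi>_pos[of x] \<mu>_pos[of x]
        by (intro mult_mono power_mono) auto
      finally show ?thesis .
    qed
    ultimately show ?thesis by blast
  qed
  have "\<phi> x \<le> K" for x
  proof (rule ccontr)
    assume "\<not> \<phi> x \<le> K"
    have "\<exists>y. K < \<phi> y \<and> 2 ^ n * ?g x \<le> ?g y" for n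
    proof (induction n)
      case 0
      then show ?case using \<open>\<not> \<phi> x \<le> K\<close> by (intro exI[of _ x]) auto
    next
      case (Suc n)
      then obtain y where y: "K < \<phi> y" "2 ^ n * ?g x \<le> ?g y" by blast
      obtain z where z: "K < \<phi> z" "2 * ?g y \<le> ?g z" using step[OF y(1)] by blast
      have "2 ^ Suc n * ?g x \<le> ?g z" using y(2) z(2) by simp
      then show ?case using z(1) by blast
    qed
    then have bound: "2 ^ n * ?g x \<le> (\<Sum>\<^sub>\<infinity>x. ?g x)" for n using g_le order_trans by blast
    have "0 < ?g x" using \<phi>_pos[of x] \<mu>_pos[of x] by simp
    then have "2 ^ n \<le> (\<Sum>\<^sub>\<infinity>x. ?g x) / ?g x" for n
      using bound[of n] by (simp only: pos_le_divide_eq)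
    moreover obtain n where "(\<Sum>\<^sub>\<infinity>x. ?g x) / ?g x < 2 ^ n"
      using real_arch_pow[of 2] by auto
    ultimately show False by (meson not_le)
  qed
  then show ?thesis by blast
qed

text \<open>One application of the eigenvalue equation improves the bound \<open>K\<close> to
  \<open>K / (l * V x)\<close>, which is small where the confining potential is large.\<close>

lemma ground_state_vanishes:
  assumes "confining V" and bound: "\<And>x. \<phi> x \<le> K" and "0 < \<epsilon>"
  shows "finite {x. \<phi> x > \<epsilon>}"
proof -
  obtain M :: nat where M: "K / (l * \<epsilon>) \<le> real M" using real_arch_simple by blast
  obtain B where B: "finite B" "\<And>x. x \<notin> B \<Longrightarrow> real (max M 1) \<le> V x"
    using assms(1) unfolding confining_def by (metis max.cobounded2)
  have "\<phi> x \<le> \<epsilon>" if "x \<notin> B" for x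
  proof -
    have "K / (l * \<epsilon>) \<le> V x" using M B(2)[OF that] by simp
    then have "K / (l * V x) \<le> \<epsilon>"
      using eigenvalue_pos V_pos[of x] \<open>0 < \<epsilon>\<close> by (simp add: field_simps)
    moreover have "\<phi> x \<le> K / (l * V x)" using ground_state_le bound by blast
    ultimately show ?thesis by simp
  qed
  then have "{x. \<phi> x > \<epsilon>} \<subseteq> B" using not_le by blast
  then show ?thesis using B(1) finite_subset by blast
qed

text \<open>A step lowers the level by at most one, so \<open>ground_state_le\<close> can be
  iterated \<open>n\<close> times before the level falls below \<open>s\<close>. The condition is
  \<open>s + n \<le> \<rho> x\<close> rather than equality because neighbours may also lie farther
  out, where \<open>V\<close> is no smaller.\<close>

lemma ground_state_le_prod_spheres:
  fixes \<rho> :: "'a \<Rightarrow> nat"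
  assumes \<rho>_step: "\<And>x y. P x y \<noteq> 0 \<Longrightarrow> \<rho> x \<le> \<rho> y + 1"
    and V_ge: "\<And>x k. k \<le> \<rho> x \<Longrightarrow> W k \<le> V x" and W_pos: "\<And>k. 0 < W k"
    and far: "\<And>x. s \<le> \<rho> x \<Longrightarrow> \<phi> x \<le> \<epsilon>" and "0 \<le> \<epsilon>" and "s + n \<le> \<rho> x"
  shows "\<phi> x \<le> \<epsilon> * (\<Prod>k\<in>{s<..s + n}. 1 / (l * W k))"
  using \<open>s + n \<le> \<rho> x\<close>
proof (induction n arbitrary: x)
  case 0
  then show ?case using far by simp
next
  case (Suc n)
  let ?K = "\<epsilon> * (\<Prod>k\<in>{s<..s + n}. 1 / (l * W k))"
  have nonneg: "0 \<le> ?K"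
    using \<open>0 \<le> \<epsilon>\<close> eigenvalue_pos W_pos
    by (intro mult_nonneg_nonneg prod_nonneg) (auto simp: less_imp_le)
  have "\<phi> y \<le> ?K" if "P x y \<noteq> 0" for y
    using Suc.IH[of y] Suc.prems \<rho>_step[OF that] by simp
  then have "\<phi> x \<le> ?K / (l * V x)" by (rule ground_state_le)
  also have "\<dots> \<le> ?K / (l * W (s + Suc n))"
    using nonneg V_ge[OF Suc.prems] W_pos[of "s + Suc n"] eigenvalue_pos V_pos[of x]
    by (intro divide_left_mono mult_left_mono mult_pos_pos) auto
  also have "\<dots> = \<epsilon> * (\<Prod>k\<in>{s<..s + Suc n}. 1 / (l * W k))"
  proof -
    have "{s<..s + Suc n} = insert (s + Suc n) {s<..s + n}" by auto
    then show ?thesis by simp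
  qed
  finally show ?case .
qed

end

section \<open>Comparison of the two bounds far from the centre\<close>

theorem proposition5p1:
  fixes E :: "'a set set"
    and P P' :: "'a \<Rightarrow> 'a \<Rightarrow> real"
    and V \<mu> \<phi> \<phi>' :: "'a \<Rightarrow> real"
  assumes "countable (UNIV :: 'a set)" and "infinite (UNIV :: 'a set)"
    and "graph E" and "graph_connected E" and "finite_geometry E"
    and "prob_kernel P" and "\<And>x y. P x y > 0 \<longleftrightarrow> adjacent E x y"
    and "prob_kernel P'" and "\<And>x. \<mu> x > 0"
    and "\<And>x y. \<mu> x * P x y = \<mu> y * P' y x"
    and "potential V" and "confining V"
    and "\<exists>x0.
           (\<forall>x y. graph_dist E x x0 = graph_dist E y x0 \<longrightarrow> V x = V y) \<and>
           (\<forall>x y. graph_dist E x x0 \<ge> graph_dist E y x0 \<longrightarrow> V x \<ge> V y)"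
    and "ground_state \<mu> (fk_op P V) (fk_lambda0 P V \<mu>) \<phi>"
    and "ground_state \<mu> (fk_dual_op P' V) (fk_lambda0 P V \<mu>) \<phi>'"
    and "\<phi>' \<in> ell1 \<mu>"
    and "Inf {P x y | x y. adjacent E x y} > 0"
  shows "\<not> aIUC P V \<mu> \<phi> \<phi>'"
proof
  let ?l = "fk_lambda0 P V \<mu>"
  assume "aIUC P V \<mu> \<phi> \<phi>'"
  then obtain n C where C: "\<And>x y. fk_kernel P V \<mu> n x y / (?l ^ n * \<phi> x * \<phi>' y) \<le> C"
    by (auto simp: aIUC_def bdd_above_def)
  obtain x0 where V_sphere: "\<And>x y. graph_dist E x x0 = graph_dist E y x0 \<Longrightarrow> V x = V y"
    and V_mono: "\<And>x y. graph_dist E x x0 \<ge> graph_dist E y x0 \<Longrightarrow> V x \<ge> V y"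
    using assms(13) by blast
  define \<rho> where "\<rho> x = graph_dist E x x0" for x
  \<comment> \<open>The radial profile of \<open>V\<close>: the choice of representative is
    harmless, as every sphere is inhabited and \<open>V\<close> is constant on it.\<close>
  define W where "W k = V (SOME x. \<rho> x = k)" for k
  define p where "p = Inf {P x y | x y. adjacent E x y}"

  have P_nonneg: "0 \<le> P x y" and P_le_1: "P x y \<le> 1" and P'_le_1: "P' x y \<le> 1" for x y
    using assms(6,8) by (auto simp: prob_kernel_def)
  have adj: "P x y \<noteq> 0 \<longleftrightarrow> adjacent E x y" for x y
    using assms(7)[of x y] P_nonneg[of x y] by linarith
  have fin: "finite {y. P x y \<noteq> 0}" for x
    using assms(5) by (simp add: adj finite_geometry_def)
  have fin': "finite {z. P z y \<noteq> 0}" for y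
    using assms(5) by (simp add: adj finite_geometry_def adjacent_commute[of E _ y])
  have V_pos: "0 < V x" for x using assms(11) by (simp add: potential_def)
  have \<phi>: "\<phi> \<in> ell2 \<mu>" "\<And>x. 0 < \<phi> x" "\<And>x. fk_op P V \<phi> x = ?l * \<phi> x"
    using assms(14) by (auto simp: ground_state_def)
  have \<phi>'_pos: "0 < \<phi>' x" for x using assms(15) by (simp add: ground_state_def)
  note gs = assms(6) fin V_pos \<phi>(2,3)
  have l_pos: "0 < ?l" by (rule eigenvalue_pos[OF gs])

  have p_pos: "0 < p" using assms(17) by (simp add: p_def)
  have p_le: "p \<le> P x y" if "adjacent E x y" for x y
    unfolding p_def using that P_nonneg by (intro cInf_lower bdd_belowI[of _ 0]) auto
  \<comment> \<open>An actual edge is needed to bound the infimum \<open>p\<close> by a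
    probability.\<close>
  have "\<exists>x y. adjacent E x y"
    using graph_dist_attained[OF assms(2,4,5), of x0 "Suc 0"] graph_dist_descend[OF assms(4)]
    by blast
  then have p_le_1: "p \<le> 1" using p_le P_le_1 order_trans by blast
  \<comment> \<open>The duality relation, together with \<open>P' y x \<le> 1\<close>, limits how
    fast \<open>\<mu>\<close> can decay along an edge.\<close>
  have \<mu>_step: "p * \<mu> x \<le> \<mu> y" if "P x y \<noteq> 0" for x y
  proof -
    have "p * \<mu> x \<le> \<mu> x * P x y"
      using p_le that assms(9)[of x] by (simp add: adj mult.commute)
    also have "\<dots> = \<mu> y * P' y x" by (rule assms(10))
    also have "\<dots> \<le> \<mu> y" using P'_le_1[of y x] assms(9)[of y] by simp
    finally show ?thesis .
  qed

  have V_eq: "V x = W (\<rho> x)" for x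
    unfolding W_def \<rho>_def by (rule V_sphere, rule sym, rule someI) simp
  have W_le: "W k \<le> V x" if "k \<le> \<rho> x" for k x
  proof -
    obtain z where "\<rho> z = k" using graph_dist_attained[OF assms(2,4,5)] \<rho>_def by metis
    then show ?thesis using V_mono[of z x] that by (auto simp: \<rho>_def V_eq)
  qed
  have W_pos: "0 < W k" for k by (simp add: W_def V_pos)
  have \<rho>_step: "\<rho> x \<le> \<rho> y + 1" if "P x y \<noteq> 0" for x y
    unfolding \<rho>_def using that adj by (intro graph_dist_adjacent_le assms(4)) auto
  have descend: "\<exists>y. p \<le> P x y \<and> \<rho> y = k" if "\<rho> x = Suc k" for x k
    using graph_dist_descend[OF assms(4)] that p_le unfolding \<rho>_def by blast

  \<comment> \<open>Summability of the dual ground state enters here: a single term is at most the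
    whole sum.\<close>
  have "(\<lambda>x. \<bar>\<phi>' x\<bar> * \<mu> x) summable_on UNIV" using assms(16) by (simp add: ell1_def)
  then have L: "\<phi>' x * \<mu> x \<le> (\<Sum>\<^sub>\<infinity>x. \<bar>\<phi>' x\<bar> * \<mu> x)" for x
    using le_infsum_of_nonneg[of "\<lambda>x. \<bar>\<phi>' x\<bar> * \<mu> x" x] assms(9) \<phi>'_pos
    by (simp add: less_imp_le)
  \<comment> \<open>Both maxima with 1 make \<open>D\<close> positive whatever the sign of
    \<open>C\<close>.\<close>
  define D where "D = max 1 C * (max 1 (\<Sum>\<^sub>\<infinity>x. \<bar>\<phi>' x\<bar> * \<mu> x))"
  have D_pos: "0 < D" by (simp add: D_def)
  have kernel_le: "fk_kernel P V \<mu> n x y * \<mu> y \<le> D * ?l ^ n * \<phi> x" for x y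
  proof -
    have "fk_kernel P V \<mu> n x y \<le> C * (?l ^ n * \<phi> x * \<phi>' y)"
      using C[of x y] l_pos \<phi>(2)[of x] \<phi>'_pos[of y] by (simp add: pos_divide_le_eq)
    then have "fk_kernel P V \<mu> n x y * \<mu> y \<le> C * (?l ^ n * \<phi> x * \<phi>' y) * \<mu> y"
      using assms(9)[of y] by (intro mult_right_mono) auto
    also have "\<dots> = C * (\<phi>' y * \<mu> y) * (?l ^ n * \<phi> x)" by simp
    also have "\<dots> \<le> D * (?l ^ n * \<phi> x)"
      unfolding D_def using l_pos \<phi>(2)[of x] \<phi>'_pos[of y] assms(9)[of y] L[of y]
      by (intro mult_right_mono mult_mono) (auto simp: le_max_iff_disj less_imp_le)
    finally show ?thesis by simp
  qed

  obtain K where K: "\<And>x. \<phi> x \<le> K"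
    using ground_state_bounded[OF gs assms(12) \<phi>(1) assms(9) p_pos p_le_1 \<mu>_step] by blast
  \<comment> \<open>Chosen so that \<open>D * \<epsilon>\<close> is half of \<open>p ^ n\<close>,
    the constant in the lower bound.\<close>
  define \<epsilon> where "\<epsilon> = p ^ n / (2 * D)"
  have \<epsilon>_pos: "0 < \<epsilon>" using p_pos D_pos by (simp add: \<epsilon>_def)
  have "finite (\<rho> ` {x. \<phi> x > \<epsilon>})"
    using ground_state_vanishes[OF gs assms(12) K \<epsilon>_pos] by (rule finite_imageI)
  then obtain s where "\<forall>k\<in>\<rho> ` {x. \<phi> x > \<epsilon>}. k < s"
    using finite_nat_set_iff_bounded by blast
  then have far: "\<phi> x \<le> \<epsilon>" if "s \<le> \<rho> x" for x
    using that by (metis image_eqI mem_Collect_eq not_le)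
  \<comment> \<open>At level \<open>s + n\<close> the \<open>n\<close> steps of either estimate
    cross the same spheres and end where \<open>far\<close> still applies.\<close>
  obtain x where x: "\<rho> x = s + n"
    using graph_dist_attained[OF assms(2,4,5)] \<rho>_def by metis

  let ?W = "\<Prod>k\<in>{s<..s + n}. 1 / W k"
  have W_prod_pos: "0 < ?W" using W_pos by (intro prod_pos) simp
  obtain y where y: "(\<Prod>k\<in>{s<..s + n}. p / W k) \<le> fk_kernel P V \<mu> n x y * \<mu> y"
    using fk_kernel_ge_prod_spheres[where p = p and \<rho> = \<rho> and W = W and P = P and V = V
        and \<mu> = \<mu>, OF P_nonneg V_pos assms(9) fin' _ descend V_eq x] p_pos by auto
  have "p ^ n * ?W = (\<Prod>k\<in>{s<..s + n}. p / W k)"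
    by (simp add: prod_dividef)
  also have "\<dots> \<le> D * ?l ^ n * \<phi> x" using y kernel_le[of x y] by simp
  also have "\<dots> \<le> D * ?l ^ n * (\<epsilon> * (\<Prod>k\<in>{s<..s + n}. 1 / (?l * W k)))"
    using ground_state_le_prod_spheres[where \<rho> = \<rho> and W = W, OF gs \<rho>_step W_le W_pos far] \<epsilon>_pos x
      D_pos l_pos
    by (intro mult_left_mono) auto
  \<comment> \<open>The \<open>n\<close> eigenvalue factors in the product cancel
    \<open>?l ^ n\<close>; the common \<open>?W\<close> is cancelled last.\<close>
  also have "\<dots> = D * \<epsilon> * ?W"
    using l_pos by (simp add: prod_dividef prod.distrib)
  also have "\<dots> = p ^ n / 2 * ?W" using D_pos by (simp add: \<epsilon>_def)
  finally have "p ^ n \<le> p ^ n / 2" using W_prod_pos by (simp only: mult_le_cancel_right_pos)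
  then show False using zero_less_power[OF p_pos, of n] by linarith
qed

end
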